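(* Let $p$ be an odd prime, let $m$ be a positive integer, and let $h$ be a primitive of $\mathbb{Z}_p$. For $\ell=1,\dots,p-1$, let $z_\ell:=\exp\left(2\pi i\frac{\ell}{p-1}\right)$ (where $i=\sqrt{-1}$), so that $\{z_\ell:\ell=1,\dots,p-1\}$ are the distinct $(p-1)$st roots of unity. Then the complete set of eigenvectors of $A_{p,m}$ is $$\nu_\ell=\sum_{j=1}^{p-1}z_\ell^j\,e_{(h^j\,(\mathbb{Z}_p))},\qquad \ell=1,\dots,p-1,$$ where $e_a$ denotes the $a$th standard unit (column) vector in $\mathbb{C}^{p-1}$ (that is, $\nu_1,\dots,\nu_{p-1}$ are eigenvectors of $A_{p,m}$ forming a basis of $\mathbb{C}^{p-1}$), and the eigenvalue of $A_{p,m}$ corresponding to $\nu_\ell$ is $$\lambda_\ell=\sum_{j=1}^{p-1}z_\ell^j\,(h^j\,(\mathbb{Z}_p))^m.$$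
   Context: For an integer $a$ and an integer $p>1$, $a\,(\mathbb{Z}_p)$ denotes the remainder $r\in\{0,1,\dots,p-1\}$ of $a$ on division by $p$, regarded as an integer. For an odd prime $p$ and $1\le i\le p-1$, $i^{-1}$ denotes the multiplicative inverse of $i$ modulo $p$. For an odd prime $p$ and a positive integer $m$, $A_{p,m}$ is the $(p-1)\times(p-1)$ matrix $A_{p,m}=\left[(i^{-1}\cdot j\,(\mathbb{Z}_p))^m\right]_{i,j=1}^{p-1}$, where the outer exponentiation is taken in the integers. A nonzero element $h$ of $\mathbb{Z}_p$ is called primitive (a primitive of $\mathbb{Z}_p$) if $\{h^k\,(\mathbb{Z}_p):1\le k\le p-1\}=\{1,2,\dots,p-1\}$. *)

theory Defs
  imports
    "Jordan_Normal_Form.Char_Poly"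
    "Jordan_Normal_Form.VS_Connect"
    "HOL-Number_Theory.Modular_Inverse"
begin

(* Rows and columns of a mat are indexed from 0, hence the shift by one.  The inverse is the
   representative in {0..<p}; its sort requires a ring, so residues are computed in int. *)
definition A_mat :: "nat \<Rightarrow> nat \<Rightarrow> int mat" where
  "A_mat p m = mat (p - 1) (p - 1)
     (\<lambda>(i, j). ((modular_inverse (int p) (int (i + 1)) * int (j + 1)) mod int p) ^ m)"

definition primitive_mod :: "nat \<Rightarrow> nat \<Rightarrow> bool" where
  "primitive_mod p h \<longleftrightarrow>
     h \<in> {1..p - 1} \<and> {h ^ k mod p |k. k \<in> {1..p - 1}} = {1..p - 1}"

definition z :: "nat \<Rightarrow> nat \<Rightarrow> complex" where
  "z p l = exp (2 * of_real pi * \<i> * (of_nat l / of_nat (p - 1)))"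

(* The vector e_a (1 <= a <= n) is unit_vec n (a - 1).  For a primitive h all h ^ j mod p are
   positive, so the natural number subtraction does not truncate. *)
definition nu :: "nat \<Rightarrow> nat \<Rightarrow> nat \<Rightarrow> complex vec" where
  "nu p h l = finsum_vec TYPE(complex) (p - 1)
     (\<lambda>j. z p l ^ j \<cdot>\<^sub>v unit_vec (p - 1) (h ^ j mod p - 1)) {1..p - 1}"

definition lam :: "nat \<Rightarrow> nat \<Rightarrow> nat \<Rightarrow> nat \<Rightarrow> complex" where
  "lam p m h l = (\<Sum>j = 1..p - 1. z p l ^ j * of_nat ((h ^ j mod p) ^ m))"

end

theory Submission
  imports Defs "HOL-Number_Theory.Residues"
begin

(* Indexing the coordinates by powers of h turns A_{p,m} into a circulant matrix, whose entry at
   (h^s, h^(s+u)) is (h^u mod p)^m and so depends on u only.  In this indexing nu_l is the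
   character t |-> z_l^t of the cyclic group of order p - 1.  Characters are eigenvectors of every
   circulant matrix, and distinct characters are orthogonal, hence linearly independent. *)

section \<open>Roots of unity and orthogonality of characters\<close>

lemma sum_powers_root_unity:
  fixes w :: "'a :: field"
  assumes "w ^ n = 1"
  shows "(\<Sum>j = 1..n. w ^ j) = (if w = 1 then of_nat n else 0)"
proof (cases "w = 1")
  case False
  have "(\<Sum>j = 1..n. w ^ j) = w * (\<Sum>j<n. w ^ j)"
    by (simp add: sum_distrib_left sum.atLeast1_atMost_eq)
  then show ?thesis
    using False assms by (simp add: geometric_sum)
qed simp

text \<open>The root 1 has index \<open>p - 1\<close> here but index 0 in
  \<open>bij_betw_roots_unity\<close>; reducing the index mod \<open>p - 1\<close> reconciles the
  two numberings.\<close>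

lemma z_eq_cis_mod:
  assumes "l \<in> {1..p - 1}"
  shows "z p l = cis (2 * pi * real (l mod (p - 1)) / real (p - 1))"
proof -
  have "z p l = cis (2 * pi * real l / real (p - 1))"
    by (simp add: z_def cis_conv_exp mult_ac)
  with assms show ?thesis
    by (cases "l = p - 1") auto
qed

lemma z_power:
  assumes "p > 1"
  shows "z p l ^ (p - 1) = 1"
proof -
  have "z p l ^ (p - 1) = exp (2 * of_real pi * \<i> * of_nat l)"
    using assms by (simp add: z_def flip: exp_of_nat_mult)
  also have "\<dots> = exp (2 * of_real pi * \<i>) ^ l"
    by (simp only: mult.commute[of _ "of_nat l"] exp_of_nat_mult)
  finally show ?thesis
    by simp
qed

lemma z_nonzero: "z p l \<noteq> 0"
  by (simp add: z_def)

lemma inj_on_z: "inj_on (z p) {1..p - 1}"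
proof (rule inj_onI)
  fix k l assume kl: "k \<in> {1..p - 1}" "l \<in> {1..p - 1}" and eq: "z p k = z p l"
  then have n: "p - 1 > 0"
    by auto
  have "k mod (p - 1) = l mod (p - 1)"
    using inj_onD[OF bij_betw_imp_inj_on[OF bij_betw_roots_unity[OF n]],
        of "k mod (p - 1)" "l mod (p - 1)"] eq n
    by (simp add: z_eq_cis_mod[OF kl(1)] z_eq_cis_mod[OF kl(2)])
  with kl show "k = l"
    by (cases "k = p - 1"; cases "l = p - 1") auto
qed

text \<open>There are exactly \<open>p - 1\<close> such roots of unity, so the injective map
  \<open>z p\<close> must reach all of them.\<close>

lemma z_image:
  assumes "p > 1"
  shows "z p ` {1..p - 1} = {w. w ^ (p - 1) = 1}"
proof (rule card_subset_eq)
  show "finite {w :: complex. w ^ (p - 1) = 1}"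
    using card_roots_unity_eq[of "p - 1"] assms by (intro card_ge_0_finite) simp
  show "z p ` {1..p - 1} \<subseteq> {w. w ^ (p - 1) = 1}"
    using z_power[OF assms] by auto
  show "card (z p ` {1..p - 1}) = card {w :: complex. w ^ (p - 1) = 1}"
    using card_roots_unity_eq[of "p - 1"] card_image[OF inj_on_z, of p] assms by simp
qed

text \<open>The quotient \<open>z p l / z p k\<close> is again a root of unity, and it is 1 only for
  \<open>l = k\<close>. Dividing by \<open>z p k ^ j\<close> replaces the complex conjugate of the
  usual inner product.\<close>

lemma sum_z_orthogonal:
  assumes "p > 1" "k \<in> {1..p - 1}" "l \<in> {1..p - 1}"
  shows "(\<Sum>j = 1..p - 1. z p l ^ j / z p k ^ j) = (if l = k then of_nat (p - 1) else 0)"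
proof -
  have "(z p l / z p k) ^ (p - 1) = 1"
    using z_power[OF assms(1)] by (simp add: power_divide)
  from sum_powers_root_unity[OF this] have
    "(\<Sum>j = 1..p - 1. z p l ^ j / z p k ^ j) = (if z p l / z p k = 1 then of_nat (p - 1) else 0)"
    by (simp add: power_divide)
  moreover have "z p l / z p k = 1 \<longleftrightarrow> l = k"
    using inj_onD[OF inj_on_z] assms z_nonzero[of p k] by auto
  ultimately show ?thesis
    by simp
qed

text \<open>Fourier inversion: pairing the vanishing combination with the character of index
  \<open>k\<close> leaves \<open>c k\<close> times \<open>p - 1\<close>.\<close>

lemma z_combination_zeroD:
  assumes p: "p > 1" and k: "k \<in> {1..p - 1}"
    and zero: "\<And>j. j \<in> {1..p - 1} \<Longrightarrow> (\<Sum>l = 1..p - 1. c l * z p l ^ j) = 0"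
  shows "c k = 0"
proof -
  have "0 = (\<Sum>j = 1..p - 1. (\<Sum>l = 1..p - 1. c l * z p l ^ j) / z p k ^ j)"
    using zero by simp
  also have "\<dots> = (\<Sum>j = 1..p - 1. \<Sum>l = 1..p - 1. c l * (z p l ^ j / z p k ^ j))"
    by (simp add: sum_divide_distrib)
  also have "\<dots> = (\<Sum>l = 1..p - 1. c l * (\<Sum>j = 1..p - 1. z p l ^ j / z p k ^ j))"
    by (subst sum.swap) (simp add: sum_distrib_left)
  also have "\<dots> = (\<Sum>l = 1..p - 1. if l = k then c l * of_nat (p - 1) else 0)"
    using sum_z_orthogonal[OF p k] by (intro sum.cong) auto
  also have "\<dots> = c k * of_nat (p - 1)"
    using k by simp
  finally show ?thesis
    using p by simp
qed

section \<open>Powers of a primitive as an indexing of the coordinates\<close>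

lemma primitive_mod_bij:
  assumes "primitive_mod p h"
  shows "bij_betw (\<lambda>k. h ^ k mod p) {1..p - 1} {1..p - 1}"
proof -
  have "(\<lambda>k. h ^ k mod p) ` {1..p - 1} = {1..p - 1}"
    using assms unfolding primitive_mod_def by (simp only: Setcompr_eq_image Collect_mem_eq)
  then show ?thesis
    unfolding bij_betw_def by (auto intro: eq_card_imp_inj_on)
qed

lemma primitive_mod_coprime:
  assumes "prime p" "primitive_mod p h"
  shows "coprime h p"
proof -
  have "\<not> p dvd h"
    using assms prime_gt_1_nat[of p] by (auto simp: primitive_mod_def dest: dvd_imp_le)
  then show ?thesis
    using prime_imp_coprime[OF assms(1)] by (simp add: coprime_commute)
qed

text \<open>Exponents outside \<open>{1..p - 1}\<close> are needed because sums \<open>s + u\<close>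
  occur below. The lower bound keeps the index \<open>h ^ k mod p - 1\<close> from
  truncating.\<close>

lemma power_mod_in_range:
  assumes "prime p" "primitive_mod p h"
  shows "h ^ k mod p \<in> {1..p - 1}"
proof -
  have "coprime (h ^ k) p"
    using primitive_mod_coprime[OF assms] by simp
  then have "\<not> p dvd h ^ k"
    using assms(1) by (metis coprime_common_divisor_nat dvd_refl not_prime_1)
  moreover have "h ^ k mod p < p"
    using assms(1) by (simp add: prime_gt_0_nat)
  ultimately show ?thesis
    by (auto simp: dvd_eq_mod_eq_0)
qed

text \<open>Shifting the exponent by \<open>s\<close> multiplies by the unit \<open>h ^ s\<close>,
  which can be cancelled. The shift lets the columns of the matrix be enumerated relative to the row
  \<open>h ^ s\<close>.\<close>

lemma primitive_mod_bij_index: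
  assumes "prime p" "primitive_mod p h"
  shows "bij_betw (\<lambda>u. h ^ (s + u) mod p - 1) {1..p - 1} {0..<p - 1}"
proof -
  have inj: "inj_on (\<lambda>u. h ^ (s + u) mod p - 1) {1..p - 1}"
  proof (rule inj_onI)
    fix u v assume uv: "u \<in> {1..p - 1}" "v \<in> {1..p - 1}"
      and "h ^ (s + u) mod p - 1 = h ^ (s + v) mod p - 1"
    then have "h ^ (s + u) mod p = h ^ (s + v) mod p"
      using power_mod_in_range[OF assms, of "s + u"] power_mod_in_range[OF assms, of "s + v"]
      by (simp only: atLeastAtMost_iff) linarith
    then have "[h ^ s * h ^ u = h ^ s * h ^ v] (mod p)"
      by (simp add: cong_def power_add)
    then have "[h ^ u = h ^ v] (mod p)"
      using primitive_mod_coprime[OF assms] by (simp add: cong_mult_lcancel_nat)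
    then show "u = v"
      using inj_onD[OF bij_betw_imp_inj_on[OF primitive_mod_bij[OF assms(2)]] _ uv]
      by (simp add: cong_def)
  qed
  moreover have "(\<lambda>u. h ^ (s + u) mod p - 1) ` {1..p - 1} = {0..<p - 1}"
  proof (rule card_subset_eq)
    show "(\<lambda>u. h ^ (s + u) mod p - 1) ` {1..p - 1} \<subseteq> {0..<p - 1}"
    proof (rule image_subsetI)
      fix u
      show "h ^ (s + u) mod p - 1 \<in> {0..<p - 1}"
        using power_mod_in_range[OF assms, of "s + u"]
        by (simp only: atLeastAtMost_iff atLeastLessThan_iff) linarith
    qed
  qed (use card_image[OF inj] in auto)
  ultimately show ?thesis
    by (simp add: bij_betw_def)
qed

section \<open>Coordinates of \<open>nu\<close> and the circulant form of the matrix\<close>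

lemma nu_carrier: "nu p h l \<in> carrier_vec (p - 1)"
  unfolding nu_def by (rule finsum_vec_closed) auto

lemma nu_index:
  assumes "prime p" "primitive_mod p h" "t > 0"
  shows "nu p h l $ (h ^ t mod p - 1) = z p l ^ t"
  using assms(3)
proof (induction t rule: less_induct)
  case (less t)
  show ?case
  proof (cases "t \<le> p - 1")
    case True
    with less.prems have t: "t \<in> {1..p - 1}"
      by simp
    have bij: "bij_betw (\<lambda>j. h ^ j mod p - 1) {1..p - 1} {0..<p - 1}"
      using primitive_mod_bij_index[OF assms(1,2), of 0] by simp
    have lt: "h ^ j mod p - 1 < p - 1" if "j \<in> {1..p - 1}" for j
      using bij_betwE[OF bij] that by auto
    \<comment> \<open>Distinct exponents in \<open>{1..p - 1}\<close> give distinct unit vectors, so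
      only the summand \<open>j = t\<close> survives at this coordinate.\<close>
    have eq: "h ^ t mod p - 1 = h ^ j mod p - 1 \<longleftrightarrow> j = t" if "j \<in> {1..p - 1}" for j
      using inj_on_eq_iff[OF bij_betw_imp_inj_on[OF bij] t that] by auto
    have "nu p h l $ (h ^ t mod p - 1) =
        (\<Sum>j = 1..p - 1. (z p l ^ j \<cdot>\<^sub>v unit_vec (p - 1) (h ^ j mod p - 1)) $ (h ^ t mod p - 1))"
      unfolding nu_def using lt[OF t] by (intro index_finsum_vec) auto
    also have "\<dots> = (\<Sum>j = 1..p - 1. if j = t then z p l ^ j else 0)"
    proof (rule sum.cong)
      fix j assume j: "j \<in> {1..p - 1}"
      show "(z p l ^ j \<cdot>\<^sub>v unit_vec (p - 1) (h ^ j mod p - 1)) $ (h ^ t mod p - 1) =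
          (if j = t then z p l ^ j else 0)"
        using lt[OF t] lt[OF j] eq[OF j] by (auto simp: index_unit_vec)
    qed simp
    also have "\<dots> = z p l ^ t"
      using t by simp
    finally show ?thesis .
  next
    \<comment> \<open>Both sides have period \<open>p - 1\<close> in \<open>t\<close>: the index by
      Fermat's theorem, the power of \<open>z p l\<close> because it is a root of unity. So
      \<open>t\<close> may be lowered by \<open>p - 1\<close> and stays positive.\<close>
    case False
    have p: "p > 1"
      using assms(1) by (rule prime_gt_1_nat)
    have "\<not> p dvd h"
      using assms(2) by (auto simp: primitive_mod_def dest: dvd_imp_le)
    then have "[h ^ (p - 1) = 1] (mod p)"
      using fermat_theorem assms(1) by blast
    then have "[h ^ (t - (p - 1)) * h ^ (p - 1) = h ^ (t - (p - 1)) * 1] (mod p)"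
      by (intro cong_mult cong_refl)
    then have "h ^ t mod p = h ^ (t - (p - 1)) mod p"
      using False by (simp add: cong_def flip: power_add)
    moreover have "z p l ^ t = z p l ^ (t - (p - 1)) * z p l ^ (p - 1)"
      using False by (simp flip: power_add)
    ultimately show ?thesis
      using less.IH[of "t - (p - 1)"] False p z_power[OF p] by simp
  qed
qed

text \<open>The inverse of \<open>h ^ s\<close> cancels the factor \<open>h ^ s\<close> of
  \<open>h ^ (s + u)\<close> modulo \<open>p\<close>. This is the circulant structure.\<close>

lemma A_mat_index:
  assumes "prime p" "primitive_mod p h"
  shows "A_mat p m $$ (h ^ s mod p - 1, h ^ (s + u) mod p - 1) = int ((h ^ u mod p) ^ m)"
proof -
  let ?inv = "modular_inverse (int p) (int (h ^ s mod p))"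
  \<comment> \<open>The \<open>+ 1\<close> in \<open>A_mat\<close> undoes the shift of the index,
    since these residues are positive.\<close>
  have pos: "h ^ k mod p - 1 + 1 = h ^ k mod p" "h ^ k mod p - 1 < p - 1" for k
    using power_mod_in_range[OF assms, of k] by (simp_all only: atLeastAtMost_iff) linarith+
  have "coprime (int (h ^ s mod p)) (int p)"
    using primitive_mod_coprime[OF assms] prime_gt_0_nat[OF assms(1)]
    by simp
  then have inv: "[?inv * int (h ^ s mod p) = 1] (mod int p)"
    by (rule cong_modular_inverse2)
  have "[int (h ^ (s + u) mod p) = int (h ^ s mod p) * int (h ^ u)] (mod int p)"
    by (simp add: cong_def zmod_int power_add mod_simps)
  then have "[?inv * int (h ^ (s + u) mod p) = ?inv * (int (h ^ s mod p) * int (h ^ u))] (mod int p)"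
    by (intro cong_mult cong_refl)
  also have "?inv * (int (h ^ s mod p) * int (h ^ u)) = (?inv * int (h ^ s mod p)) * int (h ^ u)"
    by (simp add: mult.assoc)
  also have "[\<dots> = 1 * int (h ^ u)] (mod int p)"
    by (intro cong_mult inv cong_refl)
  finally have "?inv * int (h ^ (s + u) mod p) mod int p = int (h ^ u mod p)"
    by (simp add: cong_def zmod_int)
  then show ?thesis
    unfolding A_mat_def by (simp only: index_mat pos split of_nat_power)
qed

lemma eigenvector_nu:
  assumes "prime p" "primitive_mod p h"
  shows "eigenvector (map_mat of_int (A_mat p m)) (nu p h l) (lam p m h l)"
proof -
  define n where "n = p - 1"
  define A :: "complex mat" where "A = map_mat of_int (A_mat p m)"
  have A: "A \<in> carrier_mat n n"
    by (simp add: A_def A_mat_def n_def)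
  have n: "n > 0"
    using prime_gt_1_nat[OF assms(1)] by (simp add: n_def)
  have v: "nu p h l \<in> carrier_vec n"
    unfolding n_def by (rule nu_carrier)
  have lt: "h ^ k mod p - 1 < n" for k
    using power_mod_in_range[OF assms, of k] by (simp only: atLeastAtMost_iff n_def) linarith
  have "nu p h l $ (h ^ 1 mod p - 1) \<noteq> 0"
    by (subst nu_index[OF assms]) (simp_all add: z_nonzero)
  then have nonzero: "nu p h l \<noteq> 0\<^sub>v n"
    using lt[of 1] by auto
  have "A *\<^sub>v nu p h l = lam p m h l \<cdot>\<^sub>v nu p h l"
  proof (rule eq_vecI)
    fix i assume "i < dim_vec (lam p m h l \<cdot>\<^sub>v nu p h l)"
    then have i: "i < n"
      using v by simp
    \<comment> \<open>Shift 0 shows that every row index comes from a power of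
      \<open>h\<close>.\<close>
    have "(\<lambda>u. h ^ (0 + u) mod p - 1) ` {1..n} = {0..<n}"
      unfolding n_def by (intro bij_betw_imp_surj_on primitive_mod_bij_index assms)
    with i have "i \<in> (\<lambda>u. h ^ (0 + u) mod p - 1) ` {1..n}"
      by (simp only: atLeastLessThan_iff) simp
    then obtain s where s: "s \<in> {1..n}" "i = h ^ s mod p - 1"
      unfolding add_0 by (rule imageE)
    have "(A *\<^sub>v nu p h l) $ i = (\<Sum>j = 0..<n. A $$ (i, j) * nu p h l $ j)"
      using A v i by (simp add: scalar_prod_def)
    \<comment> \<open>Enumerating the columns from the row's own exponent \<open>s\<close> makes the
      matrix entry depend on \<open>u\<close> alone.\<close>
    also have "\<dots> = (\<Sum>u = 1..n. A $$ (i, h ^ (s + u) mod p - 1) * nu p h l $ (h ^ (s + u) mod p - 1))"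
      using sum.reindex_bij_betw[OF primitive_mod_bij_index[OF assms, of s],
          of "\<lambda>j. A $$ (i, j) * nu p h l $ j"]
      by (simp add: n_def)
    also have "\<dots> = (\<Sum>u = 1..n. of_nat ((h ^ u mod p) ^ m) * z p l ^ (s + u))"
    proof (rule sum.cong)
      fix u assume u: "u \<in> {1..n}"
      have "A $$ (i, h ^ (s + u) mod p - 1) =
          of_int (A_mat p m $$ (h ^ s mod p - 1, h ^ (s + u) mod p - 1))"
        using lt[of s] lt[of "s + u"] A unfolding A_def s(2) by (intro index_map_mat(1)) auto
      also have "\<dots> = of_nat ((h ^ u mod p) ^ m)"
        by (simp only: A_mat_index[OF assms] of_int_of_nat_eq)
      finally have 1: "A $$ (i, h ^ (s + u) mod p - 1) = of_nat ((h ^ u mod p) ^ m)" .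
      have 2: "nu p h l $ (h ^ (s + u) mod p - 1) = z p l ^ (s + u)"
        using u by (intro nu_index[OF assms]) auto
      show "A $$ (i, h ^ (s + u) mod p - 1) * nu p h l $ (h ^ (s + u) mod p - 1) =
          of_nat ((h ^ u mod p) ^ m) * z p l ^ (s + u)"
        by (simp only: 1 2)
    qed simp
    \<comment> \<open>Multiplicativity of the character splits off \<open>z p l ^ s\<close>, the
      coordinate of \<open>nu p h l\<close> at \<open>i\<close>.\<close>
    also have "\<dots> = lam p m h l * z p l ^ s"
      unfolding lam_def n_def sum_distrib_right by (intro sum.cong) (simp_all add: power_add)
    also have "\<dots> = (lam p m h l \<cdot>\<^sub>v nu p h l) $ i"
      using nu_index[OF assms, of s l] s v i by simp
    finally show "(A *\<^sub>v nu p h l) $ i = (lam p m h l \<cdot>\<^sub>v nu p h l) $ i" .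
  qed (use A v in simp)
  with A v nonzero show ?thesis
    by (simp add: eigenvector_def flip: A_def)
qed

section \<open>Linear independence and the basis\<close>

lemma inj_on_nu:
  assumes "prime p" "primitive_mod p h"
  shows "inj_on (nu p h) {1..p - 1}"
proof (rule inj_onI)
  fix k l assume kl: "k \<in> {1..p - 1}" "l \<in> {1..p - 1}" and eq: "nu p h k = nu p h l"
  have "z p k = z p l"
    using nu_index[OF assms, of 1 k] nu_index[OF assms, of 1 l] eq by simp
  with kl show "k = l"
    by (intro inj_onD[OF inj_on_z])
qed

text \<open>Independence suffices, as the number of vectors equals the dimension. Reading a linear
  relation at the coordinates \<open>h ^ j\<close> turns it into a vanishing combination of
  characters.\<close>

lemma basis_nu:
  assumes "prime p" "primitive_mod p h"
  shows "vectorspace.basis class_ring (module_vec TYPE(complex) (p - 1)) (nu p h ` {1..p - 1})"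
proof -
  interpret vec_space "TYPE(complex)" "p - 1" .
  let ?B = "nu p h ` {1..p - 1}"
  have B: "?B \<subseteq> carrier_vec (p - 1)"
    by (intro image_subsetI nu_carrier)
  have "lin_indpt ?B"
  proof (rule finite_lin_indpt2)
    fix a :: "complex vec \<Rightarrow> complex"
    assume zero: "lincomb a ?B = 0\<^sub>v (p - 1)"
    have "(\<Sum>l = 1..p - 1. a (nu p h l) * z p l ^ j) = 0" if "j \<in> {1..p - 1}" for j
    proof -
      have lt: "h ^ j mod p - 1 < p - 1"
        using power_mod_in_range[OF assms, of j] by (simp only: atLeastAtMost_iff) linarith
      have "0 = lincomb a ?B $ (h ^ j mod p - 1)"
        using lt zero by simp
      also have "\<dots> = (\<Sum>x\<in>?B. a x * x $ (h ^ j mod p - 1))"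
        by (rule lincomb_index[OF lt B])
      \<comment> \<open>\<open>lincomb\<close> sums over a set of vectors; injectivity of
        \<open>nu p h\<close> ensures that no two indices \<open>l\<close> collapse.\<close>
      also have "\<dots> = (\<Sum>l = 1..p - 1. a (nu p h l) * nu p h l $ (h ^ j mod p - 1))"
        by (simp only: sum.reindex[OF inj_on_nu[OF assms]] comp_def)
      also have "\<dots> = (\<Sum>l = 1..p - 1. a (nu p h l) * z p l ^ j)"
        using nu_index[OF assms, of j] that by simp
      finally show ?thesis
        by simp
    qed
    then have "a (nu p h k) = 0" if "k \<in> {1..p - 1}" for k
      by (rule z_combination_zeroD[OF prime_gt_1_nat[OF assms(1)] that])
    then show "\<forall>v\<in>?B. a v = 0"
      by blast
  qed (use B in auto)
  moreover have "card ?B = p - 1"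
    by (simp only: card_image[OF inj_on_nu[OF assms]] card_atLeastAtMost diff_Suc_1)
  ultimately show ?thesis
    using B by (intro dim_li_is_basis) (simp_all only: fin_dim dim_is_n finite_imageI
      finite_atLeastAtMost order_refl not_False_eq_True)
qed

theorem theorem2p6:
  fixes p m h :: nat
  assumes "prime p" and "odd p" and "m > 0" and "primitive_mod p h"
  shows "inj_on (z p) {1..p - 1} \<and> z p ` {1..p - 1} = {w. w ^ (p - 1) = 1}
    \<and> (\<forall>l\<in>{1..p - 1}. eigenvector (map_mat of_int (A_mat p m)) (nu p h l) (lam p m h l))
    \<and> inj_on (nu p h) {1..p - 1}
    \<and> vectorspace.basis class_ring (module_vec TYPE(complex) (p - 1)) (nu p h ` {1..p - 1})"
  using inj_on_z z_image[OF prime_gt_1_nat[OF assms(1)]] eigenvector_nu[OF assms(1,4)]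
    inj_on_nu[OF assms(1,4)] basis_nu[OF assms(1,4)]
  by blast

end
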